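(* Let $n\ge 2$ and let $C$ be any multiplication rule. Then the multiplication of $OH^n_C$ is not associative.
   Context: **Diagrams.** $B^n$ is the set of crossingless matchings of the $2n$ points $\{1,\dots,2n\}$ on a line: partitions of the points into $n$ pairs (arcs) which can be drawn as $n$ pairwise disjoint half-circles on one side of the line (arcs may be nested). $W$ denotes reflection in the line. For $a,b\in B^n$, $W(b)a$ is the collection of disjoint circles in the plane obtained by gluing the reflection of $b$ to $a$ along the $2n$ points; its circles correspond to the connected components of the graph on $\{1,\dots,2n\}$ whose edges are the arcs of $a$ and of $b$. $|W(b)a|$ is the number of circles. **The group $OH^n$.** For a collection of circles $S$, $V(S)$ is the free abelian group on the circles of $S$. Put $b(OH^n)a:=\bigwedge^*V(W(b)a)$ (exterior algebra over $\mathbb Z$), graded so that a wedge of $k$ circles has degree $2k+n-|W(b)a|$. Let ${}_b1_a$ be the unit of this exterior algebra and $1_a:={}_a1_a$. Set $OH^n:=\bigoplus_{a,b\in B^n}b(OH^n)a$. **Multiplication rules.** A multiplication rule $C$ consists, for each triple $(c,b,a)\in (B^n)^3$, of (i) a total order on the points $\{1,\dots,2n\}$ such that whenever $i,j$ are joined by an arc of $b$ and $k$ lies strictly between $i$ and $j$ (in the usual order), then $i$ or $j$ precedes $k$ in the order of the rule; and (ii) an orientation $i\to j$ or $j\to i$ of each arc $\{i,j\}$ of $b$. **Multiplication.** $OH^n_C$ is $OH^n$ with the following multiplication. If $c\neq b$ the product of an element of $d(OH^n)c$ with an element of $b(OH^n)a$ is $0$. For $x\in c(OH^n)b$, $y\in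 b(OH^n)a$, place $W(c)b$ above $W(b)a$; this gives a collection of circles $D_0$ and the element $x\wedge y\in\bigwedge^*V(D_0)$ (using $V(D_0)=V(W(c)b)\oplus V(W(b)a)$). Go through the points in the order given by $C$ for $(c,b,a)$; each time an arc $\{i,j\}$ of $b$ is met for the first time, do a surgery: delete the copy of this arc in $W(c)b$ and its mirror copy in $W(b)a$, and join the upper point $i$ to the lower point $i$ and the upper point $j$ to the lower point $j$ by vertical segments. Each surgery either merges two circles into one or splits one circle into two. To a merge $S_1\to S_2$ of $a_1,a_2$ into $b_1$ associate the map $\bigwedge^*V(S_1)\to\bigwedge^*V(S_2)$ induced by $a_1,a_2\mapsto b_1$ and the identity on the other circles. To a split $S_1\to S_2$ of a circle $e$ into the circle $e_i$ through point $i$ and the circle $e_j$ through point $j$, with orientation $i\to j$ of the arc, associate the map $x\mapsto (e_i-e_j)\wedge x'$, where $x'$ is obtained from $x$ by replacing $e$ by $e_i$ (equivalently by $e_j$). After all $n$ surgeries one obtains $W(c)a$, and $xy\in c(OH^n)a$ is the image of $x\wedge y$ under the composite of these maps. *)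

theory Defs
  imports "HOL-Library.Disjoint_Sets"
begin

section \<open>Exterior algebras of free abelian groups\<close>

text \<open>
  The exterior algebra over the integers of the free abelian group on a type of generators,
  as the free abelian group on the finite sets of generators: the set \<open>A\<close> stands for the wedge of
  its elements in increasing order, and an element is its function of coefficients. Any linear
  order on the generators serves; an arbitrary one is fixed for each type, which avoids
  restricting the type of generators. The product of the type is the wedge product.
\<close>

definition gen_order :: "'g rel" where
  "gen_order = (SOME r. linear_order_on UNIV r)"

definition gen_less :: "'g \<Rightarrow> 'g \<Rightarrow> bool" where
  "gen_less a b \<longleftrightarrow> (a, b) \<in> gen_order \<and> a \<noteq> b"

lemma linear_order_gen_order: "linear_order_on UNIV (gen_order :: 'g rel)"
proof -
  obtain r :: "'g rel" where "well_order_on UNIV r"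
    using well_order_on[of "UNIV :: 'g set"] by blast
  then have "linear_order_on UNIV r"
    by (simp add: well_order_on_def)
  then have "\<exists>r :: 'g rel. linear_order_on UNIV r"
    by blast
  then show ?thesis
    unfolding gen_order_def by (rule someI_ex)
qed

lemma gen_less_total:
  fixes a b :: 'g
  assumes "a \<noteq> b"
  shows "gen_less a b \<or> gen_less b a"
proof -
  have "total (gen_order :: 'g rel)"
    using linear_order_gen_order[where 'g = 'g] by (simp add: linear_order_on_def)
  then show ?thesis
    using assms by (simp add: total_on_def gen_less_def)
qed

lemma gen_less_asym:
  fixes a b :: 'g
  assumes "gen_less a b"
  shows "\<not> gen_less b a"
proof -
  have "antisym (gen_order :: 'g rel)"
    using linear_order_gen_order[where 'g = 'g]
    by (simp add: linear_order_on_def partial_order_on_def)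
  then show ?thesis
    using assms antisymD[of gen_order a b] by (auto simp: gen_less_def)
qed

lemma gen_less_trans:
  fixes a b c :: 'g
  assumes "gen_less a b" "gen_less b c"
  shows "gen_less a c"
proof -
  have "trans (gen_order :: 'g rel)"
    using linear_order_gen_order[where 'g = 'g]
    by (simp add: linear_order_on_def partial_order_on_def preorder_on_def)
  then have "(a, c) \<in> gen_order"
    using assms by (auto simp: gen_less_def intro: transD[of _ a b c])
  moreover have "a \<noteq> c"
    using assms gen_less_asym[of a b] by auto
  ultimately show ?thesis by (simp add: gen_less_def)
qed

definition shuffle_sign :: "'g set \<Rightarrow> 'g set \<Rightarrow> int" where
  "shuffle_sign A B = (\<Prod>a\<in>A. \<Prod>b\<in>B. if gen_less b a then - 1 else 1)"

lemma shuffle_sign_empty [simp]: "shuffle_sign {} B = 1" "shuffle_sign A {} = 1"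
  by (simp_all add: shuffle_sign_def)

lemma shuffle_sign_Un_left:
  "finite A \<Longrightarrow> finite B \<Longrightarrow> A \<inter> B = {} \<Longrightarrow>
    shuffle_sign (A \<union> B) E = shuffle_sign A E * shuffle_sign B E"
  by (simp add: shuffle_sign_def prod.union_disjoint)

lemma shuffle_sign_Un_right:
  "finite A \<Longrightarrow> finite B \<Longrightarrow> A \<inter> B = {} \<Longrightarrow>
    shuffle_sign E (A \<union> B) = shuffle_sign E A * shuffle_sign E B"
  unfolding shuffle_sign_def prod.distrib[symmetric]
  by (rule prod.cong[OF refl], rule prod.union_disjoint)

typedef 'g exterior =
  "{x :: 'g set \<Rightarrow> int. finite {A. x A \<noteq> 0} \<and> (\<forall>A. x A \<noteq> 0 \<longrightarrow> finite A)}"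
  morphisms coefficient Abs_exterior
  by (rule exI[of _ "\<lambda>_. 0"]) simp

setup_lifting type_definition_exterior

lemma exterior_eqI: "(\<And>A. coefficient x A = coefficient y A) \<Longrightarrow> x = y"
  by (metis coefficient_inject ext)

lemma finite_coefficient: "coefficient x A \<noteq> 0 \<Longrightarrow> finite A"
  using coefficient[of x] by blast

lemma finite_support: "finite {A. coefficient x A \<noteq> 0}"
  using coefficient[of x] by blast

instantiation exterior :: (type) ring_1
begin

lift_definition zero_exterior :: "'a exterior" is "\<lambda>_. 0"
  by simp

lift_definition one_exterior :: "'a exterior" is "\<lambda>A. if A = {} then 1 else 0"
  by (simp split: if_splits)

lift_definition plus_exterior :: "'a exterior \<Rightarrow> 'a exterior \<Rightarrow> 'a exterior"
  is "\<lambda>x y A. x A + y A"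
proof (intro CollectI conjI allI impI; (elim CollectE conjE)?)
  fix x y :: "'a set \<Rightarrow> int"
  assume "finite {A. x A \<noteq> 0}" "finite {A. y A \<noteq> 0}"
  then show "finite {A. x A + y A \<noteq> 0}"
    by (auto intro: finite_subset[of _ "{A. x A \<noteq> 0} \<union> {A. y A \<noteq> 0}"])
next
  fix x y :: "'a set \<Rightarrow> int" and A
  assume "\<forall>A. x A \<noteq> 0 \<longrightarrow> finite A" "\<forall>A. y A \<noteq> 0 \<longrightarrow> finite A" "x A + y A \<noteq> 0"
  then show "finite A" by (metis add.right_neutral)
qed

lift_definition uminus_exterior :: "'a exterior \<Rightarrow> 'a exterior" is "\<lambda>x A. - x A"
  by simp

definition minus_exterior :: "'a exterior \<Rightarrow> 'a exterior \<Rightarrow> 'a exterior" where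
  "x - y = x + - (y :: 'a exterior)"

lift_definition times_exterior :: "'a exterior \<Rightarrow> 'a exterior \<Rightarrow> 'a exterior"
  is "\<lambda>x y E. \<Sum>A\<in>Pow E. shuffle_sign A (E - A) * x A * y (E - A)"
proof (intro CollectI conjI allI impI; (elim CollectE conjE)?)
  fix x y :: "'a set \<Rightarrow> int"
  assume fin: "finite {A. x A \<noteq> 0}" "finite {A. y A \<noteq> 0}"
  have "{E. (\<Sum>A\<in>Pow E. shuffle_sign A (E - A) * x A * y (E - A)) \<noteq> 0}
      \<subseteq> (\<lambda>(A, B). A \<union> B) ` ({A. x A \<noteq> 0} \<times> {A. y A \<noteq> 0})"
  proof
    fix E assume "E \<in> {E. (\<Sum>A\<in>Pow E. shuffle_sign A (E - A) * x A * y (E - A)) \<noteq> 0}"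
    then obtain A where "A \<in> Pow E" "shuffle_sign A (E - A) * x A * y (E - A) \<noteq> 0"
      by (auto elim: sum.not_neutral_contains_not_neutral)
    then show "E \<in> (\<lambda>(A, B). A \<union> B) ` ({A. x A \<noteq> 0} \<times> {A. y A \<noteq> 0})"
      by (intro image_eqI[of _ _ "(A, E - A)"]) auto
  qed
  then show "finite {E. (\<Sum>A\<in>Pow E. shuffle_sign A (E - A) * x A * y (E - A)) \<noteq> 0}"
    using fin by (meson finite_SigmaI finite_imageI finite_subset)
next
  fix x y :: "'a set \<Rightarrow> int" and E
  assume "(\<Sum>A\<in>Pow E. shuffle_sign A (E - A) * x A * y (E - A)) \<noteq> 0"
  then show "finite E"
    by (metis (no_types, lifting) finite_Pow_iff sum.infinite)
qed

instance
proof
  fix x y z :: "'a exterior"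
  show "x + y + z = x + (y + z)" by transfer (simp add: add.assoc)
  show "x + y = y + x" by transfer (simp add: add.commute)
  show "0 + x = x" by transfer simp
  show "- x + x = 0" by transfer simp
  show "x - y = x + - y" by (rule minus_exterior_def)
  show "(x + y) * z = x * z + y * z"
    by transfer (simp add: algebra_simps sum.distrib)
  show "x * (y + z) = x * y + x * z"
    by transfer (simp add: algebra_simps sum.distrib)
  show "(0 :: 'a exterior) \<noteq> 1"
    by transfer (auto dest: fun_cong[of _ _ "{}"])
  show "1 * x = x"
  proof (rule exterior_eqI)
    fix E
    have "coefficient (1 * x) E =
        (\<Sum>A\<in>Pow E. if A = {} then coefficient x E else 0)"
      unfolding times_exterior.rep_eq one_exterior.rep_eq by (rule sum.cong) auto
    also have "\<dots> = coefficient x E"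
      by (cases "finite E") (use finite_coefficient[of x E] in auto)
    finally show "coefficient (1 * x) E = coefficient x E" .
  qed
  show "x * 1 = x"
  proof (rule exterior_eqI)
    fix E
    have "coefficient (x * 1) E =
        (\<Sum>A\<in>Pow E. if A = E then coefficient x E else 0)"
      unfolding times_exterior.rep_eq one_exterior.rep_eq by (rule sum.cong) auto
    also have "\<dots> = coefficient x E"
      by (cases "finite E") (use finite_coefficient[of x E] in auto)
    finally show "coefficient (x * 1) E = coefficient x E" .
  qed
  show "x * y * z = x * (y * z)"
  proof (rule exterior_eqI)
    fix E
    let ?x = "coefficient x" and ?y = "coefficient y" and ?z = "coefficient z"
    show "coefficient (x * y * z) E = coefficient (x * (y * z)) E"
    proof (cases "finite E")
      case False
      then have "coefficient u E = 0" for u :: "'a exterior"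
        using finite_coefficient by blast
      then show ?thesis by simp
    next
      case True
      have sub: "finite A" if "A \<subseteq> E" for A
        using that True by (rule finite_subset)
      have "coefficient (x * y * z) E = (\<Sum>D\<in>Pow E. \<Sum>A\<in>Pow D.
          shuffle_sign D (E - D) * shuffle_sign A (D - A) * ?x A * ?y (D - A) * ?z (E - D))"
        unfolding times_exterior.rep_eq sum_distrib_left sum_distrib_right
        by (intro sum.cong refl) (simp only: mult_ac)
      also have "\<dots> = (\<Sum>(D, A)\<in>Sigma (Pow E) Pow.
          shuffle_sign D (E - D) * shuffle_sign A (D - A) * ?x A * ?y (D - A) * ?z (E - D))"
        by (rule sum.Sigma) (simp_all add: True sub)
      also have "\<dots> = (\<Sum>(A, B)\<in>Sigma (Pow E) (\<lambda>A. Pow (E - A)).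
          shuffle_sign A (E - A) * shuffle_sign B (E - A - B) * ?x A * ?y B * ?z (E - A - B))"
      proof (rule sum.reindex_bij_witness
          [of _ "\<lambda>(A, B). (A \<union> B, A)" "\<lambda>(D, A). (A, D - A)"], goal_cases)
        case (5 p)
        obtain D A where p: "p = (D, A)" by fastforce
        with 5 have AD: "A \<subseteq> D" "D \<subseteq> E" by auto
        then have fin: "finite A" "finite (D - A)" "finite (E - D)"
          using sub by blast+
        have "shuffle_sign D (E - D) = shuffle_sign A (E - D) * shuffle_sign (D - A) (E - D)"
          using shuffle_sign_Un_left[of A "D - A" "E - D"] fin AD by (simp add: Un_absorb1)
        moreover have "(D - A) \<union> (E - D) = E - A" using AD by auto
        then have "shuffle_sign A (E - A) = shuffle_sign A (D - A) * shuffle_sign A (E - D)"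
          using shuffle_sign_Un_right[of "D - A" "E - D" A] fin by auto
        moreover have "E - A - (D - A) = E - D" using AD by auto
        ultimately show ?case by (simp add: p mult_ac)
      qed auto
      also have "\<dots> = (\<Sum>A\<in>Pow E. \<Sum>B\<in>Pow (E - A).
          shuffle_sign A (E - A) * shuffle_sign B (E - A - B) * ?x A * ?y B * ?z (E - A - B))"
        by (rule sum.Sigma[symmetric]) (simp_all add: True)
      also have "\<dots> = coefficient (x * (y * z)) E"
        unfolding times_exterior.rep_eq sum_distrib_left sum_distrib_right
        by (intro sum.cong refl) (simp only: mult_ac)
      finally show ?thesis .
    qed
  qed
qed

end

lift_definition generator :: "'g \<Rightarrow> 'g exterior" is "\<lambda>a A. if A = {a} then 1 else 0"
  by (simp split: if_splits)

lemma coefficient_generator_mult: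
  "coefficient (generator a * generator b) E =
    (if a \<noteq> b \<and> E = {a, b} then shuffle_sign {a} {b} else 0)"
proof (cases "finite E")
  case False
  then show ?thesis
    by (metis finite.emptyI finite.insertI finite_coefficient)
next
  case True
  have "coefficient (generator a * generator b) E =
      (\<Sum>A\<in>Pow E. if A = {a} then (if E - {a} = {b} then shuffle_sign {a} {b} else 0) else 0)"
    unfolding times_exterior.rep_eq generator.rep_eq by (rule sum.cong) auto
  also have "\<dots> = (if a \<noteq> b \<and> E = {a, b} then shuffle_sign {a} {b} else 0)"
    using True by (auto simp: sum.delta)
  finally show ?thesis .
qed

lemma generator_square: "generator a * generator a = 0"
  by (rule exterior_eqI) (simp add: coefficient_generator_mult zero_exterior.rep_eq)

lemma generator_anticommute: "generator a * generator b = - (generator b * generator a)"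
proof (cases "a = b")
  case True
  then show ?thesis by (simp add: generator_square)
next
  case False
  then have sign: "shuffle_sign {a} {b} = - shuffle_sign {b} {a}"
    using gen_less_total[of a b] gen_less_asym[of a b] gen_less_asym[of b a]
    by (auto simp: shuffle_sign_def)
  show ?thesis
  proof (rule exterior_eqI)
    fix E
    have ab: "coefficient (generator a * generator b) E =
        (if E = {a, b} then shuffle_sign {a} {b} else 0)"
      using False by (subst coefficient_generator_mult) (rule if_cong, blast, rule refl, rule refl)
    have ba: "coefficient (generator b * generator a) E =
        (if E = {a, b} then shuffle_sign {b} {a} else 0)"
      using False by (subst coefficient_generator_mult) (rule if_cong, blast, rule refl, rule refl)
    show "coefficient (generator a * generator b) E =
        coefficient (- (generator b * generator a)) E"
      unfolding uminus_exterior.rep_eq ab ba sign by (cases "E = {a, b}") simp_all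
  qed
qed

text \<open>The subalgebra generated by \<open>S\<close>, that is, the exterior algebra of the free abelian group on \<open>S\<close>.\<close>

definition exterior_on :: "'g set \<Rightarrow> 'g exterior set" where
  "exterior_on S = {x. \<forall>A. coefficient x A \<noteq> 0 \<longrightarrow> A \<subseteq> S}"

definition increasing_list :: "'g set \<Rightarrow> 'g list" where
  "increasing_list A = (THE xs. set xs = A \<and> sorted_wrt gen_less xs)"

text \<open>The algebra homomorphism induced by the map \<open>f\<close> of generators.\<close>

definition exterior_map :: "('g \<Rightarrow> 'h) \<Rightarrow> 'g exterior \<Rightarrow> 'h exterior" where
  "exterior_map f x = (\<Sum>A\<in>{A. coefficient x A \<noteq> 0}.
     of_int (coefficient x A) * prod_list (map (\<lambda>a. generator (f a)) (increasing_list A)))"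

lemma increasing_list:
  fixes A :: "'g set"
  assumes "finite A"
  shows "set (increasing_list A) = A" "sorted_wrt gen_less (increasing_list A)"
proof -
  interpret gen: linorder "\<lambda>a b :: 'g. gen_less a b \<or> a = b" gen_less
  proof
    fix x y z :: 'g
    show "gen_less x y = ((gen_less x y \<or> x = y) \<and> \<not> (gen_less y x \<or> y = x))"
      using gen_less_asym[of x y] gen_less_asym[of x x] by blast
    show "gen_less x x \<or> x = x" by simp
    show "gen_less x y \<or> x = y \<Longrightarrow> gen_less y z \<or> y = z \<Longrightarrow> gen_less x z \<or> x = z"
      using gen_less_trans[of x y z] by blast
    show "gen_less x y \<or> x = y \<Longrightarrow> gen_less y x \<or> y = x \<Longrightarrow> x = y"
      using gen_less_asym[of x y] by blast
    show "(gen_less x y \<or> x = y) \<or> (gen_less y x \<or> y = x)"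
      using gen_less_total[of x y] by blast
  qed
  obtain xs where xs: "sorted_wrt gen_less xs" "set xs = A"
    using gen.finite_set_strict_sorted[OF assms] by blast
  then have "\<exists>!xs. set xs = A \<and> sorted_wrt gen_less xs"
    by (intro ex1I[of _ xs]) (auto intro: gen.strict_sorted_equal)
  then have "set (increasing_list A) = A \<and> sorted_wrt gen_less (increasing_list A)"
    unfolding increasing_list_def by (rule theI')
  then show "set (increasing_list A) = A" "sorted_wrt gen_less (increasing_list A)"
    by auto
qed

section \<open>Crossingless matchings and circles\<close>

type_synonym matching = "nat set set"

definition crossingless_matchings :: "nat \<Rightarrow> matching set" where
  "crossingless_matchings n = {m. partition_on {1..2 * n} m \<and> (\<forall>A\<in>m. card A = 2) \<and>
     (\<forall>i j k l. {i, j} \<in> m \<longrightarrow> {k, l} \<in> m \<longrightarrow> \<not> (i < k \<and> k < j \<and> j < l))}"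

text \<open>Graphs are given by their sets of edges \<open>{p, q}\<close>.\<close>

definition component :: "'p set set \<Rightarrow> 'p \<Rightarrow> 'p set" where
  "component E p = {q. (p, q) \<in> {(u, v). {u, v} \<in> E}\<^sup>*}"

text \<open>The circles of \<open>W(b)a\<close>, each given by the set of the points it passes through.\<close>

definition circles :: "nat \<Rightarrow> matching \<Rightarrow> matching \<Rightarrow> nat set set" where
  "circles n b a = component (b \<union> a) ` {1..2 * n}"

section \<open>The group\<close>

text \<open>The component in \<open>b(OH\<^sup>n)a\<close> of an element \<open>x\<close> is \<open>x b a\<close>.\<close>

type_synonym arc_element = "matching \<Rightarrow> matching \<Rightarrow> nat set exterior"

definition OH :: "nat \<Rightarrow> arc_element set" where
  "OH n = {x. \<forall>b a. if b \<in> crossingless_matchings n \<and> a \<in> crossingless_matchings n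
     then x b a \<in> exterior_on (circles n b a) else x b a = 0}"

section \<open>Multiplication rules\<close>

text \<open>
  Both fields take the matchings \<open>c\<close>, \<open>b\<close>, \<open>a\<close> in this order. A total order on the points is given
  by the list of the points in increasing order; an orientation sends an arc \<open>{i, j}\<close> oriented
  \<open>i \<rightarrow> j\<close> to \<open>(i, j)\<close>. Values on other matchings and other sets are irrelevant.
\<close>

record mult_rule =
  point_order :: "matching \<Rightarrow> matching \<Rightarrow> matching \<Rightarrow> nat list"
  orientation :: "matching \<Rightarrow> matching \<Rightarrow> matching \<Rightarrow> nat set \<Rightarrow> nat \<times> nat"

definition precedes :: "'p list \<Rightarrow> 'p \<Rightarrow> 'p \<Rightarrow> bool" where
  "precedes xs i k \<longleftrightarrow> (\<exists>us vs ws. xs = us @ i # vs @ k # ws)"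

definition multiplication_rule :: "nat \<Rightarrow> mult_rule \<Rightarrow> bool" where
  "multiplication_rule n C \<longleftrightarrow>
    (\<forall>c\<in>crossingless_matchings n. \<forall>b\<in>crossingless_matchings n. \<forall>a\<in>crossingless_matchings n.
      distinct (point_order C c b a) \<and> set (point_order C c b a) = {1..2 * n} \<and>
      (\<forall>i j k. {i, j} \<in> b \<longrightarrow> i < k \<longrightarrow> k < j \<longrightarrow>
        precedes (point_order C c b a) i k \<or> precedes (point_order C c b a) j k) \<and>
      (\<forall>A\<in>b. case orientation C c b a A of (i, j) \<Rightarrow> A = {i, j}))"

section \<open>Surgeries and the multiplication\<close>

datatype point = Upper nat | Lower nat

text \<open>
  \<open>W(c)b\<close> placed above \<open>W(b)a\<close>, after the surgeries along the arcs of \<open>b\<close> in \<open>T\<close>. Coinciding edges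
  (an arc common to \<open>b\<close> and \<open>c\<close>, say) are identified, which does not change the components.
\<close>

definition stacked :: "matching \<Rightarrow> matching \<Rightarrow> matching \<Rightarrow> nat set set \<Rightarrow> point set set" where
  "stacked c b a T =
     image Upper ` (c \<union> (b - T)) \<union> image Lower ` ((b - T) \<union> a) \<union>
     (\<lambda>i. {Upper i, Lower i}) ` \<Union>T"

text \<open>The map of the surgery along the arc \<open>{i, j}\<close> oriented \<open>i \<rightarrow> j\<close>, after those along \<open>T\<close>.\<close>

definition surgery_map ::
  "matching \<Rightarrow> matching \<Rightarrow> matching \<Rightarrow> nat set set \<Rightarrow> nat \<times> nat \<Rightarrow>
    point set exterior \<Rightarrow> point set exterior" where
  "surgery_map c b a T = (\<lambda>(i, j) x.
     let before = component (stacked c b a T);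
         after = component (stacked c b a (insert {i, j} T))
     in if before (Upper i) \<noteq> before (Lower i)
        then exterior_map
          (\<lambda>K. if K \<in> {before (Upper i), before (Lower i)} then after (Upper i) else K) x
        else (generator (after (Upper i)) - generator (after (Upper j))) *
          exterior_map (\<lambda>K. if K = before (Upper i) then after (Upper i) else K) x)"

primrec surgeries ::
  "matching \<Rightarrow> matching \<Rightarrow> matching \<Rightarrow> (nat set \<Rightarrow> nat \<times> nat) \<Rightarrow> nat set list \<Rightarrow> nat set set \<Rightarrow>
    point set exterior \<Rightarrow> point set exterior" where
  "surgeries c b a orient [] T x = x"
| "surgeries c b a orient (A # As) T x =
     surgeries c b a orient As (insert A T) (surgery_map c b a T (orient A) x)"

text \<open>
  The arcs of \<open>b\<close> in the order in which the points of a list first meet them; \<open>remdups\<close> keeps last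
  occurrences, whence the reversals.
\<close>

definition arcs_met :: "matching \<Rightarrow> nat list \<Rightarrow> nat set list" where
  "arcs_met b ps = rev (remdups (rev (map (\<lambda>p. THE A. A \<in> b \<and> p \<in> A) ps)))"

text \<open>
  The product of \<open>x\<close> in \<open>c(OH\<^sup>n)b\<close> and \<open>y\<close> in \<open>b(OH\<^sup>n)a\<close>. After all surgeries, a circle of \<open>W(c)a\<close>
  is the set of the points \<open>i\<close> for which \<open>Upper i\<close> lies on the corresponding circle.
\<close>

definition component_product ::
  "mult_rule \<Rightarrow> matching \<Rightarrow> matching \<Rightarrow> matching \<Rightarrow>
    nat set exterior \<Rightarrow> nat set exterior \<Rightarrow> nat set exterior" where
  "component_product C c b a x y =
     exterior_map (\<lambda>K. Upper -` K)
       (surgeries c b a (orientation C c b a) (arcs_met b (point_order C c b a)) {}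
         (exterior_map (image Upper) x * exterior_map (image Lower) y))"

definition OH_mult :: "nat \<Rightarrow> mult_rule \<Rightarrow> arc_element \<Rightarrow> arc_element \<Rightarrow> arc_element" where
  "OH_mult n C x y = (\<lambda>c a.
     if c \<in> crossingless_matchings n \<and> a \<in> crossingless_matchings n
     then \<Sum>b\<in>crossingless_matchings n. component_product C c b a (x c b) (y b a)
     else 0)"

end

(*
  A split multiplies from the left by a difference of two circles. In x(yz) the splits of yz are
  performed on that factor only, so compared with (xy)z each of them has to be moved past x, at the
  cost of the sign (-1)^k for a wedge x of k circles: for odd k and a single split the two products
  differ.

  Let a and b differ only on the points 1, 2, 3, 4, where a has the arcs {1,2}, {3,4} and b has
  {1,4}, {2,3}. Take for x the circle {1,2} of W(a)a and for y, z the units of a(OH)b, b(OH)a.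
  The surgeries of yz on the circle through 1, 2, 3, 4 are a merge and a split, so
  yz = e_i - e_j with {e_i, e_j} = {{1,2}, {3,4}}, where the orientation of the second arc met
  decides which is e_i. Then x(yz) = x (e_i - e_j), while (xy)z = (e_i - e_j) e_i = - e_j e_i,
  and these are opposite and nonzero in both cases.
*)
theory Submission
  imports Defs
begin

section \<open>Induced maps of exterior algebras\<close>

text \<open>Lists may repeat entries, so circles that coincide after a merge need no separate
  treatment: their wedge is 0 by \<open>generator_square\<close>.\<close>

definition wedge :: "'g list \<Rightarrow> 'g exterior" where
  "wedge xs = prod_list (map generator xs)"

lemma wedge_simps [simp]:
  "wedge [] = 1" "wedge (x # xs) = generator x * wedge xs"
  "wedge (xs @ ys) = wedge xs * wedge ys"
  by (simp_all add: wedge_def)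

lemma exterior_map_superset:
  assumes "finite S" "{A. coefficient x A \<noteq> 0} \<subseteq> S"
  shows "exterior_map f x =
    (\<Sum>A\<in>S. of_int (coefficient x A) * wedge (map f (increasing_list A)))"
  unfolding exterior_map_def wedge_def map_map comp_def
  using assms by (intro sum.mono_neutral_left) auto

text \<open>Stated for differences because splits produce differences; the values at 0 and on
  integer multiples are deduced from it.\<close>

lemma exterior_map_diff: "exterior_map f (x - y) = exterior_map f x - exterior_map f y"
proof -
  let ?S = "{A. coefficient x A \<noteq> 0} \<union> {A. coefficient y A \<noteq> 0}"
  have S: "finite ?S" by (simp add: finite_support)
  have c: "coefficient (x - y) A = coefficient x A - coefficient y A" for A
    unfolding minus_exterior_def plus_exterior.rep_eq uminus_exterior.rep_eq by simp
  have sum: "exterior_map f u =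
      (\<Sum>A\<in>?S. of_int (coefficient u A) * wedge (map f (increasing_list A)))"
    if "{A. coefficient u A \<noteq> 0} \<subseteq> ?S" for u
    using S that by (rule exterior_map_superset)
  have "exterior_map f (x - y) =
      (\<Sum>A\<in>?S. of_int (coefficient (x - y) A) * wedge (map f (increasing_list A)))"
    by (rule sum) (auto simp: c)
  also have "\<dots> = exterior_map f x - exterior_map f y"
    unfolding sum[OF Un_upper1] sum[OF Un_upper2] sum_subtractf[symmetric]
    by (simp add: c left_diff_distrib)
  finally show ?thesis .
qed

lemma exterior_map_0 [simp]: "exterior_map f 0 = 0"
  using exterior_map_diff[of f 0 0] by simp

lemma exterior_map_of_int:
  "exterior_map f (of_int k * x) = of_int k * exterior_map f x"
proof (induction k rule: int_induct[of _ 0])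
  case (step1 i)
  \<comment> \<open>Addition is written as a subtraction so that \<open>exterior_map_diff\<close>
    applies.\<close>
  have "of_int (i + 1) * x = of_int i * x - (0 - x)" by (simp add: algebra_simps)
  then show ?case
    using step1 by (simp only: exterior_map_diff) (simp add: algebra_simps)
next
  case (step2 i)
  have "of_int (i - 1) * x = of_int i * x - x" by (simp add: algebra_simps)
  then show ?case
    using step2 by (simp only: exterior_map_diff) (simp add: algebra_simps)
qed simp

section \<open>Wedges of arbitrary lists of generators\<close>

lemma coefficient_generator_times:
  "coefficient (generator a * x) E =
    (if a \<in> E then shuffle_sign {a} (E - {a}) * coefficient x (E - {a}) else 0)"
proof (cases "finite E")
  case False
  then have "coefficient u E = 0" for u :: "'a exterior"
    using finite_coefficient by blast
  moreover have "coefficient x (E - {a}) = 0"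
    using False finite_coefficient[of x "E - {a}"] by auto
  ultimately show ?thesis by simp
next
  case True
  have "coefficient (generator a * x) E =
      (\<Sum>A\<in>Pow E. if A = {a} then shuffle_sign {a} (E - {a}) * coefficient x (E - {a}) else 0)"
    unfolding times_exterior.rep_eq generator.rep_eq by (rule sum.cong) auto
  then show ?thesis using True by (simp add: sum.delta)
qed

text \<open>Increasing lists give the basis elements: each generator precedes all later ones, so
  every shuffle sign is 1.\<close>

lemma coefficient_wedge_increasing:
  assumes "sorted_wrt gen_less xs"
  shows "coefficient (wedge xs) E = (if E = set xs then 1 else 0)"
  using assms
proof (induction xs arbitrary: E)
  case Nil
  then show ?case by (simp add: one_exterior.rep_eq)
next
  case (Cons a xs)
  have "a \<notin> set xs"
    using Cons.prems gen_less_asym[of a a] by auto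
  moreover have "shuffle_sign {a} (set xs) = 1"
    using Cons.prems gen_less_asym[of a] by (auto simp: shuffle_sign_def intro!: prod.neutral)
  ultimately show ?case
    using Cons by (auto simp: coefficient_generator_times)
qed

lemma increasing_unique:
  assumes "sorted_wrt gen_less xs" "sorted_wrt gen_less ys" "set xs = set ys"
  shows "xs = ys"
  using assms
proof (induction xs arbitrary: ys)
  case Nil
  then show ?case by simp
next
  case (Cons x xs)
  then obtain y ys' where ys: "ys = y # ys'" by (cases ys) auto
  have "x = y"
    using Cons.prems gen_less_asym[of x y] unfolding ys by (metis insertE insertI1 list.simps(15) sorted_wrt.simps(2))
  moreover have "x \<notin> set xs" "y \<notin> set ys'"
    using Cons.prems gen_less_asym[of x x] gen_less_asym[of y y] unfolding ys by auto
  moreover from calculation have "set xs = set ys'"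
    using Cons.prems(3) unfolding ys by (simp add: insert_ident)
  ultimately show ?case
    using Cons.IH Cons.prems(1,2) unfolding ys by simp
qed

lemma exterior_map_wedge_increasing:
  assumes "sorted_wrt gen_less xs"
  shows "exterior_map f (wedge xs) = wedge (map f xs)"
proof -
  have "increasing_list (set xs) = xs"
    using increasing_list[of "set xs"] assms by (intro increasing_unique) auto
  then show ?thesis
    using assms
    by (subst exterior_map_superset[of "{set xs}"]) (auto simp: coefficient_wedge_increasing)
qed

text \<open>One step of insertion sort. It uses only anticommutation and vanishing squares, which
  hold for the images under \<open>f\<close> as well; hence the common factor \<open>k\<close>. The
  bound on \<open>set zs\<close> is what keeps smaller generators in front during the
  induction.\<close>

lemma generator_times_wedge_increasing:
  fixes f :: "'g \<Rightarrow> 'h"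
  assumes "sorted_wrt gen_less ys"
  shows "\<exists>k zs. sorted_wrt gen_less zs \<and> set zs \<subseteq> insert a (set ys) \<and>
    generator a * wedge ys = of_int k * wedge zs \<and>
    generator (f a) * wedge (map f ys) = of_int k * wedge (map f zs)"
  using assms
proof (induction ys)
  case Nil
  show ?case by (intro exI[of _ 1] exI[of _ "[a]"]) simp
next
  case (Cons y ys)
  consider "a = y" | "gen_less a y" | "gen_less y a"
    using gen_less_total[of a y] by blast
  then show ?case
  proof cases
    case 1
    then show ?thesis
      by (intro exI[of _ 0] exI[of _ "[]"]) (simp add: mult.assoc[symmetric] generator_square)
  next
    case 2
    then show ?thesis
      using Cons.prems gen_less_trans[of a y]
      by (intro exI[of _ 1] exI[of _ "a # y # ys"]) auto
  next
    case 3
    obtain k zs where IH: "sorted_wrt gen_less zs" "set zs \<subseteq> insert a (set ys)"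
      "generator a * wedge ys = of_int k * wedge zs"
      "generator (f a) * wedge (map f ys) = of_int k * wedge (map f zs)"
      using Cons by auto
    \<comment> \<open>The type \<open>'x\<close> is generalised, so the same sign rule serves the
      generators and their images.\<close>
    have swap: "generator u * (generator v * w) = of_int (- k) * (generator v * w')"
      if "generator u * w = of_int k * w'" for u v :: 'x and w w'
    proof -
      have "generator u * (generator v * w) = - (generator v * (generator u * w))"
        by (simp add: mult.assoc[symmetric] generator_anticommute[of u v])
      also have "\<dots> = - (generator v * of_int k * w')"
        by (simp add: that mult.assoc)
      also have "\<dots> = of_int (- k) * (generator v * w')"
        unfolding mult_of_int_commute[symmetric] by (simp add: mult.assoc)
      finally show ?thesis .
    qed
    show ?thesis
      using IH 3 Cons.prems
      by (intro exI[of _ "- k"] exI[of _ "y # zs"]) (auto simp: swap[OF IH(3)] swap[OF IH(4)] simp del: of_int_minus)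
  qed
qed

text \<open>Multiplicativity of the induced map. Sorting \<open>xs\<close> by insertion extracts the
  same integer factor from both wedges, which reduces the claim to increasing lists.\<close>

lemma exterior_map_wedge:
  fixes f :: "'g \<Rightarrow> 'h"
  shows "exterior_map f (wedge xs) = wedge (map f xs)"
proof -
  have "\<exists>k zs. sorted_wrt gen_less zs \<and> wedge xs = of_int k * wedge zs \<and>
    wedge (map f xs) = of_int k * wedge (map f zs)"
  proof (induction xs)
    case Nil
    show ?case by (intro exI[of _ 1] exI[of _ "[]"]) simp
  next
    case (Cons x xs)
    then obtain k zs where IH: "sorted_wrt gen_less zs" "wedge xs = of_int k * wedge zs"
      "wedge (map f xs) = of_int k * wedge (map f zs)" by blast
    obtain l us where us: "sorted_wrt gen_less us"
      "generator x * wedge zs = of_int l * wedge us"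
      "generator (f x) * wedge (map f zs) = of_int l * wedge (map f us)"
      using generator_times_wedge_increasing[OF IH(1), of x f] by blast
    have comm: "u * (of_int k * v) = of_int k * (u * v)" for u v :: "'x exterior"
      by (metis mult.assoc mult_of_int_commute)
    show ?case
      using us IH by (intro exI[of _ "k * l"] exI[of _ us]) (simp add: comm mult.assoc)
  qed
  then show ?thesis
    by (metis exterior_map_of_int exterior_map_wedge_increasing)
qed

section \<open>Components\<close>

lemma component_refl [simp]: "p \<in> component E p"
  by (simp add: component_def)

lemma component_sym: "q \<in> component E p \<Longrightarrow> p \<in> component E q"
proof -
  have "sym {(u, v). {u, v} \<in> E}" by (auto simp: sym_def insert_commute)
  then show "q \<in> component E p \<Longrightarrow> p \<in> component E q"
    unfolding component_def by (auto dest: sym_rtrancl symD)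
qed

lemma component_trans: "q \<in> component E p \<Longrightarrow> r \<in> component E q \<Longrightarrow> r \<in> component E p"
  by (auto simp: component_def)

lemma component_eq_iff: "component E p = component E q \<longleftrightarrow> q \<in> component E p"
  by (metis component_refl component_sym component_trans subset_antisym subsetI)

lemma component_edge: "{p, q} \<in> E \<Longrightarrow> q \<in> component E p"
  by (auto simp: component_def)

lemma component_step: "r \<in> component E p \<Longrightarrow> {r, q} \<in> E \<Longrightarrow> q \<in> component E p"
  using component_edge component_trans by metis

lemma component_path3: "{p, q} \<in> E \<Longrightarrow> {q, r} \<in> E \<Longrightarrow> {r, s} \<in> E \<Longrightarrow> s \<in> component E p"
  by (rule component_step[OF component_step[OF component_edge]])

lemma component_induct [consumes 1, case_names refl step]:
  assumes "q \<in> component E p" "P p"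
    "\<And>u v. u \<in> component E p \<Longrightarrow> P u \<Longrightarrow> {u, v} \<in> E \<Longrightarrow> P v"
  shows "P q"
proof -
  have "(p, q) \<in> {(u, v). {u, v} \<in> E}\<^sup>*" using assms(1) by (simp add: component_def)
  then show ?thesis
    by induction (use assms(2,3) in \<open>auto simp: component_def\<close>)
qed

text \<open>Since \<open>m \<union> m\<close> is \<open>m\<close>, this describes the circles of
  \<open>W(m)m\<close>.\<close>

lemma component_matching:
  assumes "disjoint m" "{i, j} \<in> m"
  shows "component m i = {i, j}"
proof
  show "component m i \<subseteq> {i, j}"
  proof
    fix q assume "q \<in> component m i"
    then show "q \<in> {i, j}"
    proof (induction rule: component_induct)
      case (step u v)
      then show ?case
        using assms by (metis disjoint_def disjoint_iff insertCI)
    qed simp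
  qed
  show "{i, j} \<subseteq> component m i"
    using assms component_edge by fastforce
qed

section \<open>Surgeries\<close>

lemma image_pair_iff [simp]:
  "{Upper i, Upper j} \<in> image Upper ` E \<longleftrightarrow> {i, j} \<in> E"
  "{Lower i, Lower j} \<in> image Lower ` E \<longleftrightarrow> {i, j} \<in> E"
  "{Upper i, q} \<in> image Lower ` E \<longleftrightarrow> False"
  "{Lower i, q} \<in> image Upper ` E \<longleftrightarrow> False"
  "{q, Upper i} \<in> image Lower ` E \<longleftrightarrow> False"
  "{q, Lower i} \<in> image Upper ` E \<longleftrightarrow> False"
proof -
  have inj: "inj (image Upper)" "inj (image Lower)"
    by (auto intro!: injI simp: inj_image_eq_iff inj_def)
  show "{Upper i, Upper j} \<in> image Upper ` E \<longleftrightarrow> {i, j} \<in> E"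
    using inj_image_mem_iff[OF inj(1), of "{i, j}" E] by simp
  show "{Lower i, Lower j} \<in> image Lower ` E \<longleftrightarrow> {i, j} \<in> E"
    using inj_image_mem_iff[OF inj(2), of "{i, j}" E] by simp
qed blast+

lemma stacked_iff [simp]:
  "{Upper i, Upper j} \<in> stacked c b a T \<longleftrightarrow> {i, j} \<in> c \<union> (b - T)"
  "{Lower i, Lower j} \<in> stacked c b a T \<longleftrightarrow> {i, j} \<in> (b - T) \<union> a"
  "{Upper i, Lower j} \<in> stacked c b a T \<longleftrightarrow> i = j \<and> i \<in> \<Union>T"
  "{Lower j, Upper i} \<in> stacked c b a T \<longleftrightarrow> i = j \<and> i \<in> \<Union>T"
  unfolding stacked_def Un_iff image_pair_iff by (auto simp: doubleton_eq_iff image_iff)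

text \<open>Before any surgery there are no vertical edges, so the upper and the lower diagram are
  separate.\<close>

lemma component_stacked_empty:
  "component (stacked c b a {}) (Upper p) = Upper ` component (c \<union> b) p"
  "component (stacked c b a {}) (Lower p) = Lower ` component (b \<union> a) p"
proof -
  let ?E = "stacked c b a {}"
  have "q \<in> Upper ` component (c \<union> b) p" if "q \<in> component ?E (Upper p)" for q
    using that
  proof (induction rule: component_induct)
    case (step u v)
    then show ?case by (cases v) (auto intro!: imageI intro: component_step)
  qed simp
  moreover have "Upper q \<in> component ?E (Upper p)" if "q \<in> component (c \<union> b) p" for q
    using that by (induction rule: component_induct) (auto intro: component_step)
  ultimately show "component ?E (Upper p) = Upper ` component (c \<union> b) p" by blast
  have "q \<in> Lower ` component (b \<union> a) p" if "q \<in> component ?E (Lower p)" for q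
    using that
  proof (induction rule: component_induct)
    case (step u v)
    then show ?case by (cases v) (auto intro!: imageI intro: component_step)
  qed simp
  moreover have "Lower q \<in> component ?E (Lower p)" if "q \<in> component (b \<union> a) p" for q
    using that by (induction rule: component_induct) (auto intro: component_step)
  ultimately show "component ?E (Lower p) = Lower ` component (b \<union> a) p" by blast
qed

text \<open>After all surgeries only \<open>c\<close>, \<open>a\<close> and the vertical edges are
  left, and contracting the latter gives \<open>c \<union> a\<close>. The hypothesis puts a vertical
  edge at each end of every arc of \<open>a\<close>.\<close>

lemma component_stacked_full:
  assumes "\<Union>a \<subseteq> \<Union>b"
  shows "Upper -` component (stacked c b a b) (Upper p) = component (c \<union> a) p"
proof -
  let ?E = "stacked c b a b"
  have "q \<in> Upper ` component (c \<union> a) p \<union> Lower ` component (c \<union> a) p"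
    if "q \<in> component ?E (Upper p)" for q
    using that
  proof (induction rule: component_induct)
    case (step u v)
    then show ?case by (cases v) (auto intro!: imageI intro: component_step)
  qed simp
  moreover have "Upper q \<in> component ?E (Upper p)" if "q \<in> component (c \<union> a) p" for q
    using that
  proof (induction rule: component_induct)
    case (step u v)
    show ?case
    proof (cases "{u, v} \<in> c")
      case True
      with step show ?thesis by (auto intro: component_step)
    next
      case False
      with step have uv: "{u, v} \<in> a" by blast
      \<comment> \<open>An arc of \<open>a\<close> is followed on the upper points by going down,
        along the arc, and up again.\<close>
      with assms have "u \<in> \<Union>b" "v \<in> \<Union>b" by blast+
      with uv have "{Upper u, Lower u} \<in> ?E" "{Lower u, Lower v} \<in> ?E" "{Lower v, Upper v} \<in> ?E"
        by simp_all
      with step.IH show ?thesis by (meson component_step)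
    qed
  qed simp
  ultimately show ?thesis by blast
qed

text \<open>Circles are indexed by points on them, so a merge just replaces \<open>E\<close> by
  \<open>E'\<close>. By \<open>conn\<close> the ends of each deleted edge stay connected, hence
  components can only grow; \<open>sep\<close> selects the merge branch of
  \<open>surgery_map\<close>.\<close>

lemma surgery_map_merge:
  fixes c b a T i j
  defines "E \<equiv> component (stacked c b a T)"
    and "E' \<equiv> component (stacked c b a (insert {i, j} T))"
  assumes arc: "{i, j} \<in> b - T"
    and conn: "Upper j \<in> E' (Upper i)" "Lower j \<in> E' (Lower i)"
    and sep: "Lower i \<notin> E (Upper i)"
  shows "surgery_map c b a T (i, j) (wedge (map E ps)) = wedge (map E' ps)"
proof -
  have vert: "Lower i \<in> E' (Upper i)"
    unfolding E'_def by (rule component_edge) simp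
  have edge: "Upper j \<in> E (Upper i)" "Lower j \<in> E (Lower i)"
    unfolding E_def using arc by (auto intro: component_edge)
  have sub: "E p \<subseteq> E' p" for p
  proof
    fix q assume "q \<in> E p"
    then show "q \<in> E' p"
      unfolding E_def
    proof (induction rule: component_induct)
      case (step u v)
      have "v \<in> E' u"
      proof (cases "{u, v} \<in> stacked c b a (insert {i, j} T)")
        case True
        then show ?thesis by (simp add: E'_def component_edge)
      next
        case False
        then have "{u, v} = {Upper i, Upper j} \<or> {u, v} = {Lower i, Lower j}"
          using step.hyps by (cases u; cases v) (auto simp: doubleton_eq_iff)
        then show ?thesis
          using conn component_sym unfolding E'_def doubleton_eq_iff by metis
      qed
      with step.IH show ?case
        unfolding E'_def by (metis component_trans)
    qed (simp add: E'_def)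
  qed
  have after: "(if E p \<in> {E (Upper i), E (Lower i)} then E' (Upper i) else E p) = E' p" for p
  proof (cases "E p \<in> {E (Upper i), E (Lower i)}")
    case True
    then have "p \<in> E (Upper i) \<or> p \<in> E (Lower i)"
      unfolding E_def by (metis component_refl insertE singletonD)
    then have "p \<in> E' (Upper i)"
      using sub vert unfolding E'_def by (meson component_trans subsetD)
    then show ?thesis
      using True by (simp add: E'_def component_eq_iff)
  next
    case False
    \<comment> \<open>A component avoiding the four ends of the two copies of the arc meets no
      deleted and no new edge, so it does not change.\<close>
    then have far: "Upper i \<notin> E p" "Lower i \<notin> E p"
      by (simp_all add: E_def component_eq_iff)
    then have far': "Upper j \<notin> E p" "Lower j \<notin> E p"
      using edge unfolding E_def by (metis component_sym component_trans)+
    have "q \<in> E p" if "q \<in> E' p" for q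
      using that unfolding E'_def
    proof (induction rule: component_induct)
      case (step u v)
      have "{u, v} \<in> stacked c b a T"
        using step far far' by (cases u; cases v) auto
      with step.IH show ?case
        unfolding E_def by (rule component_step)
    qed (simp add: E_def)
    with False sub show ?thesis by auto
  qed
  have "E (Upper i) \<noteq> E (Lower i)"
    using sep by (simp add: E_def component_eq_iff)
  then have "surgery_map c b a T (i, j) (wedge (map E ps)) =
      exterior_map (\<lambda>K. if K \<in> {E (Upper i), E (Lower i)} then E' (Upper i) else K)
        (wedge (map E ps))"
    unfolding surgery_map_def Let_def E_def E'_def by simp
  also have "\<dots> = wedge (map E' ps)"
    unfolding exterior_map_wedge map_map comp_def after ..
  finally show ?thesis .
qed

text \<open>All points of \<open>ps\<close> lie on the circle being split, so every factor becomes
  the circle through \<open>i\<close>. The first term vanishes as soon as \<open>ps\<close> is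
  nonempty; keeping it treats all lengths at once.\<close>

lemma surgery_map_split:
  fixes c b a T i j
  defines "E \<equiv> component (stacked c b a T)"
    and "E' \<equiv> component (stacked c b a (insert {i, j} T))"
  assumes "Lower i \<in> E (Upper i)" and ps: "set ps \<subseteq> E (Upper i)"
  shows "surgery_map c b a T (i, j) (wedge (map E ps)) =
    wedge (map E' (Upper i # replicate (length ps) (Upper i))) -
    wedge (map E' (Upper j # replicate (length ps) (Upper i)))"
proof -
  have eq: "E (Lower i) = E (Upper i)" "\<And>p. p \<in> set ps \<Longrightarrow> E p = E (Upper i)"
    using assms by (metis component_eq_iff subsetD)+
  have "exterior_map (\<lambda>K. if K = E (Upper i) then E' (Upper i) else K) (wedge (map E ps)) =
      wedge (map E' (replicate (length ps) (Upper i)))"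
    unfolding exterior_map_wedge map_map comp_def
    by (rule arg_cong[of _ _ wedge]) (simp add: eq(2) map_replicate_const cong: map_cong)
  then show ?thesis
    using eq(1) unfolding surgery_map_def Let_def E_def E'_def by (simp add: left_diff_distrib)
qed

text \<open>Quantifying over all intermediate \<open>T'\<close> and over both namings of the ends of
  an arc makes the criterion independent of the order and of the orientations chosen by the
  rule.\<close>

lemma surgeries_merge:
  assumes "distinct As" "set As \<subseteq> b - T"
    and "\<And>A. A \<in> set As \<Longrightarrow> case orient A of (i, j) \<Rightarrow> A = {i, j}"
    and "\<And>T' i j. T \<subseteq> T' \<Longrightarrow> T' \<subseteq> T \<union> set As \<Longrightarrow> {i, j} \<in> set As - T' \<Longrightarrow>
      Upper j \<in> component (stacked c b a (insert {i, j} T')) (Upper i) \<and>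
      Lower j \<in> component (stacked c b a (insert {i, j} T')) (Lower i) \<and>
      Lower i \<notin> component (stacked c b a T') (Upper i)"
  shows "surgeries c b a orient As T (wedge (map (component (stacked c b a T)) ps)) =
    wedge (map (component (stacked c b a (T \<union> set As))) ps)"
  using assms
proof (induction As arbitrary: T)
  case Nil
  then show ?case by simp
next
  case (Cons A As)
  obtain i j where ij: "orient A = (i, j)" "A = {i, j}"
    using Cons.prems(3)[of A] by (auto split: prod.splits)
  have "surgery_map c b a T (orient A) (wedge (map (component (stacked c b a T)) ps)) =
      wedge (map (component (stacked c b a (insert A T))) ps)"
    using surgery_map_merge[of i j b T c a ps] Cons.prems(2) Cons.prems(4)[of T i j]
    by (auto simp: ij(2) ij(1)[unfolded ij(2)])
  moreover have "surgeries c b a orient As (insert A T)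
      (wedge (map (component (stacked c b a (insert A T))) ps)) =
      wedge (map (component (stacked c b a (insert A T \<union> set As))) ps)"
  proof (rule Cons.IH)
    show "distinct As" "set As \<subseteq> b - insert A T" using Cons.prems by auto
    show "case orient B of (i, j) \<Rightarrow> B = {i, j}" if "B \<in> set As" for B
      using Cons.prems(3)[of B] that by simp
  next
    fix T' i j
    assume "insert A T \<subseteq> T'" "T' \<subseteq> insert A T \<union> set As" "{i, j} \<in> set As - T'"
    then show "Upper j \<in> component (stacked c b a (insert {i, j} T')) (Upper i) \<and>
      Lower j \<in> component (stacked c b a (insert {i, j} T')) (Lower i) \<and>
      Lower i \<notin> component (stacked c b a T') (Upper i)"
      by (intro Cons.prems(4)) auto
  qed
  ultimately show ?case by simp
qed

text \<open>The two copies of the arc in \<open>c\<close> and \<open>b\<close> form a small upper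
  circle of their own, which the surgery merges into the lower circle. The copy in \<open>c\<close>
  survives and keeps the ends connected.\<close>

lemma common_arc_merge:
  assumes "disjoint c" "disjoint b" "T \<subseteq> b" "{i, j} \<in> c" "{i, j} \<in> b - T"
  shows "Upper j \<in> component (stacked c b a (insert {i, j} T)) (Upper i) \<and>
    Lower j \<in> component (stacked c b a (insert {i, j} T)) (Lower i) \<and>
    Lower i \<notin> component (stacked c b a T) (Upper i)"
proof (intro conjI)
  let ?E' = "stacked c b a (insert {i, j} T)"
  have up: "{Upper i, Upper j} \<in> ?E'" and "{Lower i, Upper i} \<in> ?E'" "{Upper j, Lower j} \<in> ?E'"
    using assms by auto
  then show "Upper j \<in> component ?E' (Upper i)" "Lower j \<in> component ?E' (Lower i)"
    by (meson component_edge component_step)+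
  have unique: "A = {i, j}" if "A \<in> c \<union> b" "i \<in> A \<or> j \<in> A" for A
    using that assms disjointD[of c A "{i, j}"] disjointD[of b A "{i, j}"] by blast
  have "q \<in> {Upper i, Upper j}" if "q \<in> component (stacked c b a T) (Upper i)" for q
    using that
  proof (induction rule: component_induct)
    case (step u v)
    then obtain k where u: "u = Upper k" "k = i \<or> k = j" by auto
    show ?case
    proof (cases v)
      case (Upper l)
      then have "{k, l} = {i, j}" using step u by (intro unique) auto
      then show ?thesis using Upper by (auto simp: doubleton_eq_iff)
    next
      case (Lower l)
      then obtain A where "A \<in> T" "k \<in> A" using step u by auto
      moreover from this have "A = {i, j}" using assms(3) u by (intro unique) auto
      ultimately show ?thesis using assms by auto
    qed
  qed simp
  then show "Lower i \<notin> component (stacked c b a T) (Upper i)" by blast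
qed

text \<open>
  Two arcs of \<open>b\<close> and two of \<open>a\<close> forming one circle of \<open>W(b)a\<close> and of \<open>W(a)b\<close>: the first surgery
  on it is a merge and the second a split.
\<close>

lemma square_merge:
  assumes "disjoint a" "disjoint b" "T \<subseteq> b" "{k, l} \<in> b - T" "{p, q} \<in> b - T"
    "{k, l} \<noteq> {p, q}" "{k, p} \<in> a" "{l, q} \<in> a"
  shows "Upper l \<in> component (stacked a b a (insert {k, l} T)) (Upper k) \<and>
    Lower l \<in> component (stacked a b a (insert {k, l} T)) (Lower k) \<and>
    Lower k \<notin> component (stacked a b a T) (Upper k)"
proof (intro conjI)
  let ?E' = "stacked a b a (insert {k, l} T)"
  \<comment> \<open>The arc \<open>{p, q}\<close> is still uncut, so the path \<open>k\<close>,
    \<open>p\<close>, \<open>q\<close>, \<open>l\<close> connects the ends of \<open>{k, l}\<close>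
    in both diagrams.\<close>
  have "{q, l} \<in> a" using assms(8) by (simp add: insert_commute)
  then have "{Upper k, Upper p} \<in> ?E'" "{Upper p, Upper q} \<in> ?E'" "{Upper q, Upper l} \<in> ?E'"
    "{Lower k, Lower p} \<in> ?E'" "{Lower p, Lower q} \<in> ?E'" "{Lower q, Lower l} \<in> ?E'"
    using assms by auto
  then show "Upper l \<in> component ?E' (Upper k)" "Lower l \<in> component ?E' (Lower k)"
    by (blast intro: component_path3)+
  have arcs_b: "A = {k, l} \<or> A = {p, q}" if "A \<in> b" "r \<in> A" "r \<in> {k, l, p, q}" for A r
    using that assms disjointD[of b A "{k, l}"] disjointD[of b A "{p, q}"] by blast
  have arcs_a: "A = {k, p} \<or> A = {l, q}" if "A \<in> a" "r \<in> A" "r \<in> {k, l, p, q}" for A r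
    using that assms disjointD[of a A "{k, p}"] disjointD[of a A "{l, q}"] by blast
  \<comment> \<open>The four points form a closed square in the upper diagram, and neither arc of
    \<open>b\<close> on it is in \<open>T\<close>, so no vertical edge leaves it.\<close>
  have "v \<in> Upper ` {k, l, p, q}" if "v \<in> component (stacked a b a T) (Upper k)" for v
    using that
  proof (induction rule: component_induct)
    case (step u v)
    then obtain r where u: "u = Upper r" "r \<in> {k, l, p, q}" by blast
    show ?case
    proof (cases v)
      case (Upper s)
      then have "{r, s} \<in> a \<or> {r, s} \<in> b" using step u by auto
      then have "s \<in> {k, l, p, q}"
        using arcs_a[of "{r, s}" r] arcs_b[of "{r, s}" r] u(2) by blast
      then show ?thesis using Upper by blast
    next
      case (Lower s)
      then obtain A where "A \<in> T" "r \<in> A" using step u by auto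
      then show ?thesis using arcs_b[of A r] u(2) assms(3-5) by blast
    qed
  qed simp
  then show "Lower k \<notin> component (stacked a b a T) (Upper k)" by blast
qed

text \<open>The vertical edge at \<open>k\<close> joins the upper and the lower part, so the surgery
  along \<open>{p, q}\<close> is a split.\<close>

lemma square_connected:
  assumes "{k, l} \<in> T" "{p, q} \<in> b - T" "{k, p} \<in> a" "{l, q} \<in> a"
  shows "Lower p \<in> component (stacked a b a T) (Upper p)"
    "Upper ` {k, l, p, q} \<subseteq> component (stacked a b a T) (Upper p)"
proof -
  let ?E = "stacked a b a T"
  have "{p, k} \<in> a" "{q, l} \<in> a" using assms(3,4) by (simp_all add: insert_commute)
  with assms have edges: "{Upper p, Upper k} \<in> ?E" "{Upper k, Lower k} \<in> ?E" "{Lower k, Lower p} \<in> ?E"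
    "{Upper p, Upper q} \<in> ?E" "{Upper q, Upper l} \<in> ?E"
    by auto
  from edges(1-3) show "Lower p \<in> component ?E (Upper p)"
    by (rule component_path3)
  have "Upper k \<in> component ?E (Upper p)" "Upper q \<in> component ?E (Upper p)"
    using component_edge[OF edges(1)] component_edge[OF edges(4)] by simp_all
  moreover from this(2) have "Upper l \<in> component ?E (Upper p)"
    using edges(5) by (rule component_step)
  ultimately show "Upper ` {k, l, p, q} \<subseteq> component ?E (Upper p)"
    by simp
qed

section \<open>Additivity of surgeries and products\<close>

lemma surgery_map_diff:
  "surgery_map c b a T ij (x - y) = surgery_map c b a T ij x - surgery_map c b a T ij y"
  by (simp add: surgery_map_def Let_def exterior_map_diff right_diff_distrib split: prod.splits)

lemma surgeries_diff:
  "surgeries c b a orient As T (x - y) =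
    surgeries c b a orient As T x - surgeries c b a orient As T y"
  by (induction As arbitrary: T x y) (simp_all add: surgery_map_diff)

lemma surgeries_append:
  "surgeries c b a orient (As @ Bs) T x =
    surgeries c b a orient Bs (T \<union> set As) (surgeries c b a orient As T x)"
  by (induction As arbitrary: T x) simp_all

lemma component_product_diff_right:
  "component_product C c b a x (y - z) = component_product C c b a x y - component_product C c b a x z"
  by (simp add: component_product_def exterior_map_diff surgeries_diff right_diff_distrib)

lemma component_product_diff_left:
  "component_product C c b a (x - y) z = component_product C c b a x z - component_product C c b a y z"
  by (simp add: component_product_def exterior_map_diff surgeries_diff left_diff_distrib)

lemma component_product_0 [simp]:
  "component_product C c b a x 0 = 0" "component_product C c b a 0 y = 0"
  using component_product_diff_right[of C c b a x 0 0] component_product_diff_left[of C c b a 0 0 y]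
  by simp_all

section \<open>Products\<close>

lemma crossingless_matchingD:
  assumes "m \<in> crossingless_matchings n"
  shows "disjoint m" "\<Union>m = {1..2 * n}"
  using assms by (auto simp: crossingless_matchings_def partition_on_def)

lemma multiplication_ruleD:
  assumes "multiplication_rule n C" "c \<in> crossingless_matchings n"
    "b \<in> crossingless_matchings n" "a \<in> crossingless_matchings n"
  shows "distinct (arcs_met b (point_order C c b a))"
    "set (arcs_met b (point_order C c b a)) = b"
    "\<And>A. A \<in> b \<Longrightarrow> case orientation C c b a A of (i, j) \<Rightarrow> A = {i, j}"
proof -
  have order: "set (point_order C c b a) = {1..2 * n}"
    using assms by (simp add: multiplication_rule_def)
  show "\<And>A. A \<in> b \<Longrightarrow> case orientation C c b a A of (i, j) \<Rightarrow> A = {i, j}"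
    using assms by (simp add: multiplication_rule_def)
  show "distinct (arcs_met b (point_order C c b a))"
    by (simp add: arcs_met_def)
  have the: "(THE A. A \<in> b \<and> p \<in> A) = A" if "A \<in> b" "p \<in> A" for A p
    using that crossingless_matchingD(1)[OF assms(3)]
    by (intro the_equality) (auto simp: disjoint_def)
  have nonempty: "A \<noteq> {}" if "A \<in> b" for A
    using that assms(3) by (auto simp: crossingless_matchings_def)
  have "(\<lambda>p. THE A. A \<in> b \<and> p \<in> A) ` \<Union>b = b"
  proof (intro equalityI subsetI)
    fix A assume "A \<in> b"
    moreover from this obtain p where "p \<in> A" using nonempty by blast
    ultimately show "A \<in> (\<lambda>p. THE A. A \<in> b \<and> p \<in> A) ` \<Union>b"
      using the by (intro image_eqI[of _ _ p]) auto
  qed (auto simp: the)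
  then show "set (arcs_met b (point_order C c b a)) = b"
    by (simp add: arcs_met_def order crossingless_matchingD(2)[OF assms(3)])
qed

text \<open>When the two upper matchings agree, every arc of \<open>b\<close> is a common arc, so
  all surgeries are merges and no sign or extra factor appears.\<close>

lemma component_product_same:
  assumes C: "multiplication_rule n C"
    and b: "b \<in> crossingless_matchings n" and a: "a \<in> crossingless_matchings n"
    and qs: "set qs \<subseteq> {1..2 * n}"
  shows "component_product C b b a (wedge (map (component (b \<union> b)) ps))
      (wedge (map (component (b \<union> a)) qs)) = wedge (map (component (b \<union> a)) (ps @ qs))"
proof -
  let ?E = "\<lambda>T. component (stacked b b a T)"
  let ?As = "arcs_met b (point_order C b b a)"
  note rule = multiplication_ruleD[OF C b b a]
  note b' = crossingless_matchingD[OF b] and a' = crossingless_matchingD[OF a]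
  have "exterior_map (image Upper) (wedge (map (component (b \<union> b)) ps)) *
      exterior_map (image Lower) (wedge (map (component (b \<union> a)) qs)) =
      wedge (map (?E {}) (map Upper ps @ map Lower qs))"
    by (simp add: exterior_map_wedge component_stacked_empty comp_def)
  moreover have "surgeries b b a (orientation C b b a) ?As {}
      (wedge (map (?E {}) (map Upper ps @ map Lower qs))) =
      wedge (map (?E ({} \<union> set ?As)) (map Upper ps @ map Lower qs))"
  proof (rule surgeries_merge)
    fix T' i j
    assume "T' \<subseteq> {} \<union> set ?As" "{i, j} \<in> set ?As - T'"
    then show "Upper j \<in> component (stacked b b a (insert {i, j} T')) (Upper i) \<and>
      Lower j \<in> component (stacked b b a (insert {i, j} T')) (Lower i) \<and>
      Lower i \<notin> component (stacked b b a T') (Upper i)"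
      using rule(2) b'(1) by (intro common_arc_merge) auto
  qed (use rule in auto)
  \<comment> \<open>The vertical edges now allow lower points to be replaced by upper ones.\<close>
  moreover have "?E b (Lower q) = ?E b (Upper q)" if "q \<in> set qs" for q
    unfolding component_eq_iff using that qs b'(2) by (intro component_edge) auto
  then have "map (?E b) (map Upper ps @ map Lower qs) = map (\<lambda>p. ?E b (Upper p)) (ps @ qs)"
    by simp
  moreover have "Upper -` ?E b (Upper p) = component (b \<union> a) p" for p
    using a' b' by (intro component_stacked_full) simp
  ultimately show ?thesis
    by (simp add: component_product_def rule exterior_map_wedge comp_def del: map_append)
qed

section \<open>Elements of \<open>OH n\<close> concentrated in one summand\<close>

lemma finite_crossingless_matchings: "finite (crossingless_matchings n)"
  by (rule finite_subset[of _ "Pow (Pow {1..2 * n})"])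
    (auto simp: crossingless_matchings_def partition_on_def)

definition single :: "matching \<Rightarrow> matching \<Rightarrow> nat set exterior \<Rightarrow> arc_element" where
  "single b a u = (\<lambda>b' a'. if b' = b \<and> a' = a then u else 0)"

lemma single_in_OH:
  assumes "b \<in> crossingless_matchings n" "a \<in> crossingless_matchings n"
    "u \<in> exterior_on (circles n b a)"
  shows "single b a u \<in> OH n"
  using assms by (auto simp: OH_def single_def exterior_on_def zero_exterior.rep_eq)

lemma OH_mult_single:
  assumes "c \<in> crossingless_matchings n" "b \<in> crossingless_matchings n"
    "a \<in> crossingless_matchings n"
  shows "OH_mult n C (single c b u) (single b a v) = single c a (component_product C c b a u v)"
proof (intro ext)
  fix c' a'
  have "(\<Sum>d\<in>crossingless_matchings n. component_product C c' d a' (single c b u c' d) (single b a v d a'))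
    = (\<Sum>d\<in>crossingless_matchings n. if d = b then single c a (component_product C c b a u v) c' a' else 0)"
    by (rule sum.cong) (auto simp: single_def)
  then show "OH_mult n C (single c b u) (single b a v) c' a' =
      single c a (component_product C c b a u v) c' a'"
    using assms by (auto simp: OH_mult_def finite_crossingless_matchings) (auto simp: single_def)
qed

section \<open>Two matchings\<close>

text \<open>The arcs \<open>{5, 6}\<close>, ..., \<open>{2n - 1, 2n}\<close>. The index starts at 2
  to leave out the points 1 to 4, where the two matchings differ; for \<open>n = 2\<close> there are
  none.\<close>

definition far_arcs :: "nat \<Rightarrow> matching" where
  "far_arcs n = (\<lambda>k. {2 * k + 1, 2 * k + 2}) ` {2..<n}"

definition adjacent_matching :: "nat \<Rightarrow> matching" where
  "adjacent_matching n = {{1, 2}, {3, 4}} \<union> far_arcs n"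

definition nested_matching :: "nat \<Rightarrow> matching" where
  "nested_matching n = {{1, 4}, {2, 3}} \<union> far_arcs n"

lemma far_arcs_cases:
  assumes "A \<in> far_arcs n"
  obtains k where "2 \<le> k" "k < n" "A = {2 * k + 1, 2 * k + 2}"
  using assms by (auto simp: far_arcs_def)

lemma far_arcs_gt: "A \<in> far_arcs n \<Longrightarrow> p \<in> A \<Longrightarrow> p > 4"
  by (auto simp: far_arcs_def)

lemma disjoint_far_arcs: "disjoint (far_arcs n)"
  by (rule disjointI) (auto simp: far_arcs_def, presburger+)

lemma Union_far_arcs:
  assumes "n \<ge> 2"
  shows "\<Union>(far_arcs n) = {5..2 * n}"
proof (intro equalityI subsetI)
  fix p assume "p \<in> {5..2 * n}"
  then have "p = 2 * ((p - 1) div 2) + 1 \<or> p = 2 * ((p - 1) div 2) + 2"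
    "(p - 1) div 2 \<in> {2..<n}" by auto
  then show "p \<in> \<Union>(far_arcs n)" unfolding far_arcs_def by blast
qed (auto simp: far_arcs_def)

text \<open>A crossing would have to lie within \<open>S\<close>: no point fits strictly between the
  ends of a far arc, and an arc starting inside an arc of \<open>S\<close> starts at a point at most
  4.\<close>

lemma crossinglessI:
  assumes "n \<ge> 2" "\<Union>S = {1..4}" "disjoint S" "\<And>A. A \<in> S \<Longrightarrow> card A = 2"
    and cross: "\<And>i j k l. {i, j} \<in> S \<Longrightarrow> {k, l} \<in> S \<Longrightarrow> \<not> (i < k \<and> k < j \<and> j < l)"
  shows "S \<union> far_arcs n \<in> crossingless_matchings n"
proof -
  have low: "p \<le> 4" if "A \<in> S" "p \<in> A" for A p
    using assms(2) that by (metis UnionI atLeastAtMost_iff)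
  have "disjoint (S \<union> far_arcs n)"
    using assms(3) disjoint_far_arcs low far_arcs_gt
    by (intro disjoint_union) (auto, force)
  moreover have "card A = 2" if "A \<in> S \<union> far_arcs n" for A
    using that assms(4) by (auto simp: far_arcs_def)
  moreover from this have "{} \<notin> S \<union> far_arcs n"
    by (metis card.empty zero_neq_numeral)
  moreover have "\<Union>(S \<union> far_arcs n) = {1..2 * n}"
    using assms(1,2) Union_far_arcs by auto
  moreover have "\<not> (i < k \<and> k < j \<and> j < l)"
    if ij: "{i, j} \<in> S \<union> far_arcs n" and kl: "{k, l} \<in> S \<union> far_arcs n" for i j k l
  proof
    assume less: "i < k \<and> k < j \<and> j < l"
    have "{i, j} \<notin> far_arcs n"
      using less by (auto elim!: far_arcs_cases simp: doubleton_eq_iff)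
    then have "{i, j} \<in> S" using ij by blast
    moreover from this have "k \<le> 4" using less low[of "{i, j}" j] by auto
    then have "{k, l} \<in> S" using kl far_arcs_gt[of "{k, l}" n k] by auto
    ultimately show False using cross less by blast
  qed
  ultimately show ?thesis
    by (simp add: crossingless_matchings_def partition_on_def)
qed

lemma adjacent_matching: "n \<ge> 2 \<Longrightarrow> adjacent_matching n \<in> crossingless_matchings n"
  unfolding adjacent_matching_def
  by (rule crossinglessI) (auto simp: disjoint_def doubleton_eq_iff)

lemma nested_matching: "n \<ge> 2 \<Longrightarrow> nested_matching n \<in> crossingless_matchings n"
  unfolding nested_matching_def
  by (rule crossinglessI) (auto simp: disjoint_def doubleton_eq_iff)

text \<open>Here \<open>i\<close> and \<open>j\<close> are the ends, oriented from \<open>i\<close>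
  to \<open>j\<close>, of whichever of \<open>{1, 4}\<close> and \<open>{2, 3}\<close> is met
  second; only its surgery is a split. They do not depend on \<open>ps\<close>, so the same pair
  serves both bracketings: \<open>[]\<close> gives \<open>yz\<close> and \<open>[1]\<close> gives
  \<open>(xy)z\<close>.\<close>

lemma component_product_nested:
  fixes n
  defines "a \<equiv> adjacent_matching n" and "b \<equiv> nested_matching n"
  assumes n: "n \<ge> 2" and C: "multiplication_rule n C"
  obtains i j where "{i, j} = {1, 4} \<or> {i, j} = {2, 3}"
    "\<And>ps. set ps \<subseteq> {1..4} \<Longrightarrow>
      component_product C a b a (wedge (map (component (a \<union> b)) ps)) 1 =
      wedge (map (component (a \<union> a)) (i # replicate (length ps) i)) -
      wedge (map (component (a \<union> a)) (j # replicate (length ps) i))"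
proof -
  have a: "a \<in> crossingless_matchings n" and b: "b \<in> crossingless_matchings n"
    using n by (simp_all add: a_def b_def adjacent_matching nested_matching)
  note rule = multiplication_ruleD[OF C a b a]
  note a' = crossingless_matchingD[OF a] and b' = crossingless_matchingD[OF b]
  let ?E = "\<lambda>T. component (stacked a b a T)"
  define As where "As = arcs_met b (point_order C a b a)"
  define orient where "orient = orientation C a b a"
  have As: "distinct As" "set As = b"
    using rule by (simp_all add: As_def)
  have orient: "case orient A of (i, j) \<Rightarrow> A = {i, j}" if "A \<in> b" for A
    using rule(3) that by (simp add: orient_def)
  have b_cases: "A \<in> a \<or> A = {1, 4} \<or> A = {2, 3}" if "A \<in> b" for A
    using that by (auto simp: a_def b_def adjacent_matching_def nested_matching_def)
  have in_b: "{1, 4} \<in> set As" "{2, 3} \<in> set As"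
    by (simp_all add: As b_def nested_matching_def)
  have ne: "{1, 4} \<noteq> ({2, 3} :: nat set)" by auto
  \<comment> \<open>The arcs of \<open>b\<close> outside \<open>a\<close> may be met in either
    order; \<open>D\<close> names the first and \<open>D'\<close> the second.\<close>
  obtain us D vs D' ws where split: "As = us @ D # vs @ D' # ws"
    and D: "D = {1, 4} \<and> D' = {2, 3} \<or> D = {2, 3} \<and> D' = {1, 4}"
  proof -
    obtain xs ys where xy: "As = xs @ {1, 4} # ys"
      using in_b(1) by (meson split_list)
    then consider "{2, 3} \<in> set xs" | "{2, 3} \<in> set ys"
      using in_b(2) ne by auto
    then show ?thesis
    proof cases
      case 1
      then obtain us vs where "xs = us @ {2, 3} # vs" by (meson split_list)
      then show ?thesis using that xy by simp
    next
      case 2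
      then obtain vs ws where "ys = vs @ {2, 3} # ws" by (meson split_list)
      then show ?thesis using that xy by simp
    qed
  qed
  define T1 where "T1 = set (us @ D # vs)"
  define T2 where "T2 = insert D' T1"
  have D'b: "D' \<in> b - T1" and T1b: "T1 \<subseteq> b" and wsb: "set ws \<subseteq> b - T2" and Dws: "D \<notin> set ws"
    and T2: "T2 \<union> set ws = b" and DT1: "D \<in> T1"
    using As by (auto simp: split T1_def T2_def)
  obtain i j where ij: "orient D' = (i, j)" "D' = {i, j}"
    using orient[of D'] D'b by (auto split: prod.splits)
  have in_a: "{1, 2} \<in> a" "{2, 1} \<in> a" "{3, 4} \<in> a" "{4, 3} \<in> a"
    by (auto simp: a_def adjacent_matching_def)
  \<comment> \<open>The ends of \<open>D\<close> are named to match the orientation of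
    \<open>D'\<close>: arcs of \<open>a\<close> join \<open>k\<close> to \<open>i\<close> and
    \<open>l\<close> to \<open>j\<close>.\<close>
  obtain k l where kl: "D = {k, l}" "{k, i} \<in> a" "{l, j} \<in> a"
  proof -
    have "(i = 1 \<and> j = 4 \<or> i = 4 \<and> j = 1) \<and> D = {2, 3} \<or> (i = 2 \<and> j = 3 \<or> i = 3 \<and> j = 2) \<and> D = {1, 4}"
      using D ij(2) by (auto simp: doubleton_eq_iff)
    then show ?thesis
      using in_a that[of 2 3] that[of 3 2] that[of 1 4] that[of 4 1]
      by (elim disjE conjE) (simp_all add: insert_commute)
  qed
  \<comment> \<open>Up to and including \<open>D\<close> all surgeries are merges: far arcs are
    common to \<open>a\<close> and \<open>b\<close>, and while \<open>D\<close> is cut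
    \<open>D'\<close> is still intact.\<close>
  have before: "surgeries a b a orient (us @ D # vs) {} (wedge (map (?E {}) qs)) =
      wedge (map (?E ({} \<union> set (us @ D # vs))) qs)" for qs
  proof (rule surgeries_merge)
    show "distinct (us @ D # vs)"
      using As(1) unfolding split by auto
    show "set (us @ D # vs) \<subseteq> b - {}"
      using T1b unfolding T1_def by simp
    show "case orient A of (i, j) \<Rightarrow> A = {i, j}" if "A \<in> set (us @ D # vs)" for A
      using orient[of A] that T1b unfolding T1_def by auto
  next
    fix T' k' l'
    assume T': "T' \<subseteq> {} \<union> set (us @ D # vs)" and arc: "{k', l'} \<in> set (us @ D # vs) - T'"
    have T'b: "T' \<subseteq> b" and arc': "{k', l'} \<in> b - T'" and D'T': "D' \<in> b - T'"
      and ne': "{k', l'} \<noteq> D'"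
      using T' T1b arc D'b by (auto simp: T1_def)
    show "Upper l' \<in> component (stacked a b a (insert {k', l'} T')) (Upper k') \<and>
      Lower l' \<in> component (stacked a b a (insert {k', l'} T')) (Lower k') \<and>
      Lower k' \<notin> component (stacked a b a T') (Upper k')"
    proof (cases "{k', l'} \<in> a")
      case True
      then show ?thesis
        using a'(1) b'(1) T'b arc' by (intro common_arc_merge) auto
    next
      case False
      then have "{k', l'} = {k, l}"
        using b_cases[of "{k', l'}", OF DiffD1[OF arc']] D ne' unfolding kl(1)[symmetric] by metis
      \<comment> \<open>Swapping the names of the ends of \<open>D\<close> requires swapping
        \<open>i\<close> and \<open>j\<close> too.\<close>
      then consider "k' = k" "l' = l" | "k' = l" "l' = k"
        by (auto simp: doubleton_eq_iff)
      then show ?thesis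
      proof cases
        case 1
        with a'(1) b'(1) T'b arc' D'T' ne' kl(2,3) show ?thesis
          unfolding ij(2) by (intro square_merge[of a b T' k' l' i j]) auto
      next
        case 2
        with a'(1) b'(1) T'b arc' D'T' ne' kl(2,3) show ?thesis
          unfolding ij(2) by (intro square_merge[of a b T' k' l' j i]) (auto simp: insert_commute)
      qed
    qed
  qed
  \<comment> \<open>Only far arcs remain after \<open>D'\<close>, and these are common arcs
    again.\<close>
  have after: "surgeries a b a orient ws T2 (wedge (map (?E T2) qs)) =
      wedge (map (?E (T2 \<union> set ws)) qs)" for qs
  proof (rule surgeries_merge)
    show "distinct ws"
      using As(1) unfolding split by simp
    show "set ws \<subseteq> b - T2"
      by (rule wsb)
    show "case orient A of (i, j) \<Rightarrow> A = {i, j}" if "A \<in> set ws" for A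
      using orient[of A] that wsb by auto
  next
    fix T' k' l'
    assume T': "T' \<subseteq> T2 \<union> set ws" and arc: "{k', l'} \<in> set ws - T'"
    have "{k', l'} \<in> a"
    proof -
      have "{k', l'} \<in> b" "{k', l'} \<noteq> D" "{k', l'} \<noteq> D'"
        using arc wsb Dws by (auto simp: T2_def)
      then show ?thesis using b_cases[of "{k', l'}"] D by metis
    qed
    then show "Upper l' \<in> component (stacked a b a (insert {k', l'} T')) (Upper k') \<and>
      Lower l' \<in> component (stacked a b a (insert {k', l'} T')) (Lower k') \<and>
      Lower k' \<notin> component (stacked a b a T') (Upper k')"
      using a'(1) b'(1) T' T2 arc wsb by (intro common_arc_merge) auto
  qed
  have final: "Upper -` ?E b (Upper p) = component (a \<union> a) p" for p
    using a' b' by (intro component_stacked_full) simp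
  have product: "component_product C a b a (wedge (map (component (a \<union> b)) ps)) 1 =
      wedge (map (component (a \<union> a)) (i # replicate (length ps) i)) -
      wedge (map (component (a \<union> a)) (j # replicate (length ps) i))"
    if ps: "set ps \<subseteq> {1..4}" for ps
  proof -
    let ?qs = "map Upper ps"
    let ?r = "replicate (length ?qs) (Upper i)"
    have "exterior_map (image Upper) (wedge (map (component (a \<union> b)) ps)) *
        exterior_map (image Lower) (1 :: nat set exterior) = wedge (map (?E {}) ?qs)"
      using exterior_map_wedge[of "image Lower" "[]"]
      by (simp add: exterior_map_wedge component_stacked_empty comp_def)
    moreover have "surgeries a b a orient (us @ D # vs) {} (wedge (map (?E {}) ?qs)) =
        wedge (map (?E T1) ?qs)"
      using before[of ?qs] by (simp add: T1_def)
    \<comment> \<open>Each circle in the wedge passes through one of the points 1 to 4, so by now it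
      is the circle about to be split.\<close>
    moreover have "{1..4} = {k, l, i, j}"
    proof -
      have "{1..4} = D \<union> D'" using D by auto
      then show ?thesis unfolding kl(1) ij(2) by auto
    qed
    then have "set ?qs \<subseteq> ?E T1 (Upper i)"
      using ps square_connected(2)[of k l T1 i j b a] D'b DT1 kl ij(2) by auto
    then have "surgery_map a b a T1 (i, j) (wedge (map (?E T1) ?qs)) =
        wedge (map (?E T2) (Upper i # ?r)) - wedge (map (?E T2) (Upper j # ?r))"
      using square_connected(1)[of k l T1 i j b a] D'b DT1 kl ij(2)
      unfolding T2_def ij(2) by (intro surgery_map_split) auto
    moreover have "As = (us @ D # vs) @ D' # ws" by (simp add: split)
    ultimately have "surgeries a b a orient As {}
        (exterior_map (image Upper) (wedge (map (component (a \<union> b)) ps)) *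
        exterior_map (image Lower) (1 :: nat set exterior)) =
        wedge (map (?E b) (Upper i # ?r)) - wedge (map (?E b) (Upper j # ?r))"
      using after T2
      by (simp only: surgeries_append surgeries.simps surgeries_diff ij(1) T1_def T2_def Un_empty_left)
    then show ?thesis
      unfolding component_product_def As_def[symmetric] orient_def[symmetric]
      by (simp only: exterior_map_diff exterior_map_wedge map_map)
        (simp add: comp_def final del: wedge_simps)
  qed
  show ?thesis
    using that[of i j] product D ij(2) by blast
qed

text \<open>The coefficient at \<open>{u, v}\<close> is 1 or -1, and neither integer equals its own
  negative.\<close>

lemma generator_mult_neq_uminus:
  assumes "u \<noteq> v"
  shows "generator u * generator v \<noteq> - (generator u * generator v)"
proof
  assume "generator u * generator v = - (generator u * generator v)"
  then have "coefficient (generator u * generator v) {u, v} =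
      - coefficient (generator u * generator v) {u, v}"
    by (metis uminus_exterior.rep_eq)
  then show False
    using assms by (simp add: coefficient_generator_mult shuffle_sign_def split: if_splits)
qed

section \<open>Failure of associativity\<close>

lemma one_in_exterior_on: "1 \<in> exterior_on S"
  by (simp add: exterior_on_def one_exterior.rep_eq)

lemma generator_in_exterior_on: "K \<in> S \<Longrightarrow> generator K \<in> exterior_on S"
  by (simp add: exterior_on_def generator.rep_eq)

theorem proposition2p41:
  fixes n :: nat and C :: mult_rule
  assumes "n \<ge> 2" and "multiplication_rule n C"
  shows "\<not> (\<forall>x\<in>OH n. \<forall>y\<in>OH n. \<forall>z\<in>OH n.
           OH_mult n C (OH_mult n C x y) z = OH_mult n C x (OH_mult n C y z))"
proof
  assume assoc: "\<forall>x\<in>OH n. \<forall>y\<in>OH n. \<forall>z\<in>OH n.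
           OH_mult n C (OH_mult n C x y) z = OH_mult n C x (OH_mult n C y z)"
  define a b where "a = adjacent_matching n" and "b = nested_matching n"
  define K where "K = component (a \<union> a)"
  have a: "a \<in> crossingless_matchings n" and b: "b \<in> crossingless_matchings n"
    using assms(1) by (simp_all add: a_def b_def adjacent_matching nested_matching)
  obtain i j where ij: "{i, j} = {1, 4} \<or> {i, j} = {2, 3}"
    and product: "\<And>ps. set ps \<subseteq> {1..4} \<Longrightarrow>
      component_product C a b a (wedge (map (component (a \<union> b)) ps)) 1 =
      wedge (map K (i # replicate (length ps) i)) - wedge (map K (j # replicate (length ps) i))"
    using component_product_nested[OF assms, folded a_def b_def, folded K_def] by blast
  have K: "K p = {p, q}" if "{p, q} \<in> a" for p q
    unfolding K_def Un_absorb using crossingless_matchingD(1)[OF a] that by (rule component_matching)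
  have in_a: "{1, 2} \<in> a" "{2, 1} \<in> a" "{3, 4} \<in> a" "{4, 3} \<in> a"
    by (auto simp: a_def adjacent_matching_def)
  have K_eq: "K 1 = {1, 2}" "K 2 = {1, 2}" "K 3 = {3, 4}" "K 4 = {3, 4}"
    using in_a[THEN K] by (simp_all only: insert_commute)
  define x where "x = generator (K 1)"
  have "x \<in> exterior_on (circles n a a)"
    unfolding x_def K_def circles_def
    using assms(1) by (intro generator_in_exterior_on imageI) simp
  then have OH: "single a a x \<in> OH n" "single a b 1 \<in> OH n" "single b a 1 \<in> OH n"
    using a b by (simp_all add: single_in_OH one_in_exterior_on)
  \<comment> \<open>Here \<open>qs\<close> is empty and \<open>ps\<close> is \<open>[1]\<close>: the
    merges carry the circle of \<open>W(a)a\<close> through 1 to the circle of \<open>W(a)b\<close>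
    through 1.\<close>
  have "component_product C a a b x 1 = wedge (map (component (a \<union> b)) [1])"
    using component_product_same[OF assms(2) a b, of "[]" "[1]"] by (simp add: x_def K_def)
  \<comment> \<open>The term containing \<open>K i\<close> twice vanishes, which leaves the one with
    the minus sign.\<close>
  then have left: "component_product C a b a (component_product C a a b x 1) 1 =
      - (generator (K j) * generator (K i))"
    using product[of "[1]"] by (simp add: generator_square)
  have "component_product C a a a x (generator (K p)) = x * generator (K p)"
    if "p \<in> {1..4}" for p
    using component_product_same[OF assms(2) a a, of "[p]" "[1]"] that assms(1)
    by (simp add: x_def K_def)
  moreover have "i \<in> {1..4}" "j \<in> {1..4}"
    using ij by (auto simp: doubleton_eq_iff)
  ultimately have right: "component_product C a a a x (component_product C a b a 1 1) =
      x * generator (K i) - x * generator (K j)"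
    using product[of "[]"] by (simp add: component_product_diff_right)
  have "single a a (component_product C a b a (component_product C a a b x 1) 1) =
      single a a (component_product C a a a x (component_product C a b a 1 1))"
    using assoc[rule_format, OF OH] by (simp add: OH_mult_single a b)
  then have "- (generator (K j) * generator (K i)) = x * generator (K i) - x * generator (K j)"
    unfolding left right by (auto simp: single_def fun_eq_iff split: if_splits)
  moreover have "K i = K 1 \<and> K j = K 4 \<or> K i = K 4 \<and> K j = K 1"
    using ij K_eq by (auto simp: doubleton_eq_iff)
  \<comment> \<open>One of \<open>K i\<close> and \<open>K j\<close> is \<open>K 1\<close>, so one
    term on the right is a square and vanishes. In either case anticommutation turns the equation
    into the stated one.\<close>
  ultimately have "generator (K 1) * generator (K 4) = - (generator (K 1) * generator (K 4))"
    using generator_anticommute[of "K 1" "K 4"] by (auto simp: x_def generator_square)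
  moreover have "K 1 \<noteq> K 4"
    unfolding K_eq by auto
  ultimately show False
    using generator_mult_neq_uminus[of "K 1" "K 4"] by simp
qed

end
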